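(* Suppose $k\le n/e$. Any single-pass streaming algorithm that solves $k$-SAT on $n$ variables with success probability at least $3/4$ requires $\Omega(m)$ bits of space. Here the hard instances have, with high probability, $m=\Theta((n/k)^k)$ clauses.
   Context: $k$-SAT (decision version): given a stream of clauses over $n$ Boolean variables, each clause a disjunction of exactly $k$ literals (a literal is a variable or its negation), decide whether some Boolean assignment satisfies all clauses simultaneously. The streaming algorithm reads the clauses one by one in a single pass. Space is measured in bits. *)

theory Defs
  imports "HOL-Probability.Probability"
begin

datatype literal = Pos nat | Neg nat

type_synonym clause = "literal set"

fun literal_true :: "(nat \<Rightarrow> bool) \<Rightarrow> literal \<Rightarrow> bool" where
  "literal_true a (Pos v) = a v"
| "literal_true a (Neg v) = (\<not> a v)"

definition literals :: "nat \<Rightarrow> literal set" where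
  "literals n = Pos ` {..<n} \<union> Neg ` {..<n}"

definition kSAT_stream :: "nat \<Rightarrow> nat \<Rightarrow> clause list \<Rightarrow> bool" where
  "kSAT_stream n k \<phi> \<longleftrightarrow> (\<forall>C\<in>set \<phi>. C \<subseteq> literals n \<and> card C = k)"

definition satisfiable :: "clause list \<Rightarrow> bool" where
  "satisfiable \<phi> \<longleftrightarrow> (\<exists>a. \<forall>C\<in>set \<phi>. \<exists>l\<in>C. literal_true a l)"

text \<open>
  A randomized single-pass streaming algorithm. The memory content is a bit string, and it is the
  only information carried from one clause to the next. Randomness is available in two forms,
  neither of which is charged as space: a random seed that may be read at any time, and fresh coins
  in every step. Since a \<^typ>\<open>'a pmf\<close> has countable support, taking \<^typ>\<open>nat\<close> as the
  type of seeds is no restriction. All types are concrete, so that constants in a theorem that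
  quantifies over algorithms cannot depend on a type of states or seeds.
\<close>

record streaming_alg =
  seed :: "nat pmf"
  initial :: "nat \<Rightarrow> bool list pmf"
  step :: "nat \<Rightarrow> clause \<Rightarrow> bool list \<Rightarrow> bool list pmf"
  answer :: "nat \<Rightarrow> bool list \<Rightarrow> bool pmf"

primrec run :: "streaming_alg \<Rightarrow> nat \<Rightarrow> bool list pmf \<Rightarrow> clause list \<Rightarrow> bool list pmf" where
  "run A r \<mu> [] = \<mu>"
| "run A r \<mu> (C # \<phi>) = run A r (bind_pmf \<mu> (step A r C)) \<phi>"

definition memory :: "streaming_alg \<Rightarrow> nat \<Rightarrow> clause list \<Rightarrow> bool list pmf" where
  "memory A r \<phi> = run A r (initial A r) \<phi>"

definition verdict :: "streaming_alg \<Rightarrow> clause list \<Rightarrow> bool pmf" where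
  "verdict A \<phi> = bind_pmf (seed A) (\<lambda>r. bind_pmf (memory A r \<phi>) (answer A r))"

definition success_prob :: "streaming_alg \<Rightarrow> clause list \<Rightarrow> real" where
  "success_prob A \<phi> = pmf (verdict A \<phi>) (satisfiable \<phi>)"

definition solves_kSAT :: "nat \<Rightarrow> nat \<Rightarrow> real \<Rightarrow> streaming_alg \<Rightarrow> bool" where
  "solves_kSAT n k p A \<longleftrightarrow> (\<forall>\<phi>. kSAT_stream n k \<phi> \<longrightarrow> p \<le> success_prob A \<phi>)"

text \<open>
  At every point of the pass over the stream, and for every outcome of the random choices, the
  memory holds at most \<open>s\<close> bits. The bound is relative to a single stream, because an algorithm may
  well use unbounded space on the set of all streams, which are arbitrarily long.
\<close>

definition space_at_most :: "streaming_alg \<Rightarrow> clause list \<Rightarrow> nat \<Rightarrow> bool" where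
  "space_at_most A \<phi> s \<longleftrightarrow>
     (\<forall>r\<in>set_pmf (seed A). \<forall>i\<le>length \<phi>. \<forall>\<sigma>\<in>set_pmf (memory A r (take i \<phi>)). length \<sigma> \<le> s)"

end

theory Submission
  imports Defs
begin

text \<open>
  The indexing problem is embedded into \<open>k\<close>-SAT. Fix \<open>2 N\<close> distinct \<open>k\<close>-sets of variables, grouped
  into \<open>N\<close> pairs, with \<open>N\<close> about half of \<open>(n/k)\<^sup>k \<le> n choose k\<close>. A set \<open>X \<subseteq> {..<N}\<close> is streamed by
  sending, for each \<open>i\<close>, the all-negative clause on the first set of the \<open>i\<close>-th pair if \<open>i \<in> X\<close> and on
  the second one otherwise; so the length of the stream does not depend on \<open>X\<close>. The query \<open>j\<close> then
  sends the \<open>2\<^sup>k - 1 \<le> (n/k)\<^sup>k\<close> other clauses on the first set of the \<open>j\<close>-th pair. These force all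
  variables of that set to be true, so the formula is satisfiable iff \<open>j \<notin> X\<close>.

  For a fixed memory content after the data part, the expected number of correctly answered queries
  is a sum of independent terms over uniform \<open>X\<close>, each with mean \<open>1/2\<close>. Its exponential moment is at
  most \<open>((1 + e)/2)\<^sup>N\<close>, and a union bound over the at most \<open>4\<^sup>s\<close> memory contents gives \<open>s \<ge> N/32\<close>.
\<close>

section \<open>The indexing problem\<close>

lemma exp_le_chord:
  fixes p :: real
  assumes "0 \<le> p" "p \<le> 1"
  shows "exp p \<le> 1 - p + p * exp 1"
  using convex_onD[OF exp_convex, of p 0 1] assms by simp

text \<open>The two probabilities add up to 1, so the chord bounds add up to \<open>1 + e\<close>.
  The constant \<open>11/16\<close> lies below \<open>3/4\<close>, yet is large enough for the
  quadratic Taylor bound of \<open>exp\<close> to exceed \<open>(1 + e)/2\<close>.\<close>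

lemma exp_pmf_bool_le: "exp (pmf q True) + exp (pmf q False) \<le> 2 * exp (11/16 :: real)"
proof -
  have "exp (pmf q True) \<le> 1 - pmf q True + pmf q True * exp 1"
    by (intro exp_le_chord pmf_nonneg pmf_le_1)
  moreover have "exp (pmf q False) \<le> 1 - pmf q False + pmf q False * exp 1"
    by (intro exp_le_chord pmf_nonneg pmf_le_1)
  moreover have "pmf q False = 1 - pmf q True"
    by (rule pmf_False_conv_True)
  ultimately have "exp (pmf q True) + exp (pmf q False) \<le> 1 + exp (1::real)"
    by (simp only: left_diff_distrib)
  also have "\<dots> \<le> 2 * (1 + 11/16 + (11/16)\<^sup>2 / 2)"
    using e_less_272 by (simp add: power2_eq_square)
  also have "\<dots> \<le> 2 * exp (11/16 :: real)"
    using exp_lower_Taylor_quadratic[of "11/16"] by simp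
  finally show ?thesis .
qed

text \<open>Each summand is a product over \<open>J\<close> whose factor at \<open>j\<close> depends
  only on whether \<open>j \<in> X\<close>. Summing over all \<open>X\<close> expands a product of
  two-term sums.\<close>

lemma sum_exp_answers_le:
  fixes q :: "'i \<Rightarrow> bool pmf"
  assumes "finite J"
  shows "(\<Sum>X\<in>Pow J. exp (\<Sum>j\<in>J. pmf (q j) (j \<notin> X))) \<le> 2 ^ card J * exp (11/16 * card J)"
proof -
  have "(\<Sum>X\<in>Pow J. exp (\<Sum>j\<in>J. pmf (q j) (j \<notin> X))) =
        (\<Sum>X\<in>Pow J. (\<Prod>j\<in>X. exp (pmf (q j) False)) * (\<Prod>j\<in>J-X. exp (pmf (q j) True)))"
  proof (rule sum.cong)
    fix X assume X: "X \<in> Pow J"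
    then have "(\<Prod>j\<in>J. exp (pmf (q j) (j \<notin> X))) =
        (\<Prod>j\<in>J-X. exp (pmf (q j) (j \<notin> X))) * (\<Prod>j\<in>X. exp (pmf (q j) (j \<notin> X)))"
      using assms by (intro prod.subset_diff) auto
    then show "exp (\<Sum>j\<in>J. pmf (q j) (j \<notin> X)) =
        (\<Prod>j\<in>X. exp (pmf (q j) False)) * (\<Prod>j\<in>J-X. exp (pmf (q j) True))"
      using assms by (simp add: exp_sum)
  qed simp
  also have "\<dots> = (\<Prod>j\<in>J. exp (pmf (q j) False) + exp (pmf (q j) True))"
    using assms by (simp add: prod_add)
  also have "\<dots> \<le> (\<Prod>j\<in>J. 2 * exp (11/16))"
    using exp_pmf_bool_le by (intro prod_mono) (auto simp: add.commute add_nonneg_nonneg)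
  also have "\<dots> = 2 ^ card J * exp (11/16 * card J)"
    by (simp add: power_mult_distrib exp_of_nat_mult[symmetric] mult.commute)
  finally show ?thesis .
qed

text \<open>Here \<open>\<mu> X\<close> stands for the memory after the data part and
  \<open>q j\<close> for the answer to query \<open>j\<close> from it. As the memory may depend on
  \<open>X\<close>, its best content in \<open>M\<close> has to be allowed for, at the price
  \<open>ln (card M)\<close>.\<close>

lemma index_success_le:
  fixes \<mu> :: "'i set \<Rightarrow> 'm pmf" and q :: "'i \<Rightarrow> 'm \<Rightarrow> bool pmf"
  assumes "finite J" "finite M"
    and supp: "\<And>X. X \<subseteq> J \<Longrightarrow> set_pmf (\<mu> X) \<subseteq> M"
  shows "(\<Sum>X\<in>Pow J. \<Sum>j\<in>J. pmf (bind_pmf (\<mu> X) (q j)) (j \<notin> X))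
         \<le> 2 ^ card J * (11/16 * card J + ln (card M))"
proof -
  define \<theta> where "\<theta> = 11/16 * card J + ln (card M)"
  have "M \<noteq> {}"
    using supp[of "{}"] set_pmf_not_empty[of "\<mu> {}"] by auto
  then have "card M > 0"
    using assms by (simp add: card_gt_0_iff)
  then have exp_\<theta>: "exp \<theta> = exp (11/16 * card J) * card M"
    by (simp add: \<theta>_def exp_add)
  \<comment> \<open>The exponential bounds the maximum over \<open>M\<close> by a sum, and \<open>y - \<theta> \<le> exp (y - \<theta>) - 1\<close> removes it
    again without a logarithm of an expectation.\<close>
  have bound: "(\<Sum>j\<in>J. pmf (bind_pmf (\<mu> X) (q j)) (j \<notin> X))
      \<le> \<theta> - 1 + (\<Sum>\<sigma>\<in>M. exp (\<Sum>j\<in>J. pmf (q j \<sigma>) (j \<notin> X))) / exp \<theta>"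
    (is "_ \<le> ?B") if "X \<subseteq> J" for X
  proof -
    have int: "integrable (measure_pmf (\<mu> X)) (\<lambda>\<sigma>. pmf (q j \<sigma>) b)" for j b
      by (rule measure_pmf.integrable_const_bound[where B = 1]) (auto simp: pmf_le_1)
    have "(\<Sum>j\<in>J. pmf (bind_pmf (\<mu> X) (q j)) (j \<notin> X)) =
        measure_pmf.expectation (\<mu> X) (\<lambda>\<sigma>. \<Sum>j\<in>J. pmf (q j \<sigma>) (j \<notin> X))"
      by (simp add: pmf_bind int)
    also have "\<dots> \<le> ?B"
    proof (rule measure_pmf.integral_le_const)
      show "integrable (measure_pmf (\<mu> X)) (\<lambda>\<sigma>. \<Sum>j\<in>J. pmf (q j \<sigma>) (j \<notin> X))"
        by (simp add: int)
      show "AE \<sigma> in measure_pmf (\<mu> X). (\<Sum>j\<in>J. pmf (q j \<sigma>) (j \<notin> X)) \<le> ?B"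
      proof (rule AE_pmfI)
        fix \<sigma> assume "\<sigma> \<in> set_pmf (\<mu> X)"
        then have "\<sigma> \<in> M" using supp that by auto
        define y where "y = (\<lambda>\<sigma>. \<Sum>j\<in>J. pmf (q j \<sigma>) (j \<notin> X))"
        have "y \<sigma> \<le> \<theta> - 1 + exp (y \<sigma> - \<theta>)"
          using exp_ge_add_one_self[of "y \<sigma> - \<theta>"] by linarith
        also have "exp (y \<sigma> - \<theta>) = exp (y \<sigma>) / exp \<theta>"
          by (rule exp_diff)
        also have "\<dots> \<le> (\<Sum>\<sigma>\<in>M. exp (y \<sigma>)) / exp \<theta>"
          using \<open>\<sigma> \<in> M\<close> assms by (intro divide_right_mono member_le_sum) auto
        finally show "(\<Sum>j\<in>J. pmf (q j \<sigma>) (j \<notin> X)) \<le> ?B"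
          by (simp add: y_def)
      qed
    qed
    finally show ?thesis .
  qed
  have "(\<Sum>X\<in>Pow J. \<Sum>j\<in>J. pmf (bind_pmf (\<mu> X) (q j)) (j \<notin> X)) \<le>
      (\<Sum>X\<in>Pow J. \<theta> - 1 + (\<Sum>\<sigma>\<in>M. exp (\<Sum>j\<in>J. pmf (q j \<sigma>) (j \<notin> X))) / exp \<theta>)"
    by (intro sum_mono bound) auto
  \<comment> \<open>After the swap the memory content is fixed before \<open>X\<close> varies, so
    the answers no longer depend on \<open>X\<close> and the moment bound applies.\<close>
  also have "\<dots> = 2 ^ card J * (\<theta> - 1) +
      (\<Sum>\<sigma>\<in>M. \<Sum>X\<in>Pow J. exp (\<Sum>j\<in>J. pmf (q j \<sigma>) (j \<notin> X))) / exp \<theta>"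
    using assms by (subst sum.swap)
      (simp add: sum.distrib card_Pow sum_divide_distrib[symmetric])
  also have "\<dots> \<le> 2 ^ card J * (\<theta> - 1) + (\<Sum>\<sigma>\<in>M. 2 ^ card J * exp (11/16 * card J)) / exp \<theta>"
    using assms by (intro add_left_mono divide_right_mono sum_mono sum_exp_answers_le) auto
  \<comment> \<open>\<open>\<theta>\<close> is chosen so that the quotient equals
    \<open>2 ^ card J\<close>, which cancels the \<open>- 1\<close>.\<close>
  also have "\<dots> = 2 ^ card J * \<theta>"
    using \<open>card M > 0\<close> by (simp add: exp_\<theta> field_simps)
  finally show ?thesis
    by (simp add: \<theta>_def)
qed

section \<open>Counting memory contents\<close>

lemma finite_bool_lists_length_le: "finite {\<sigma> :: bool list. length \<sigma> \<le> s}"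
  using finite_lists_length_le[of "UNIV :: bool set" s] by simp

text \<open>\<open>4 ^ s\<close> is used in place of the exact \<open>2 ^ (s + 1) - 1\<close>
  because its logarithm is proportional to \<open>s\<close>, without an additive constant.\<close>

lemma card_bool_lists_length_le: "card {\<sigma> :: bool list. length \<sigma> \<le> s} \<le> 4 ^ s"
proof -
  have "card {\<sigma> :: bool list. length \<sigma> \<le> s} = (\<Sum>i\<le>s. 2 ^ i)"
    using card_lists_length_le[of "UNIV :: bool set" s] by simp
  also have "\<dots> \<le> 4 ^ s"
  proof (induction s)
    case (Suc s)
    have "(2::nat) ^ s \<le> 4 ^ s"
      by (rule power_mono) auto
    with Suc show ?case by simp
  qed simp
  finally show ?thesis .
qed

section \<open>Streams that encode the indexing problem\<close>

text \<open>For \<open>P \<subseteq> S\<close>, this clause excludes exactly the assignments that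
  are false on \<open>P\<close> and true on \<open>S - P\<close>.\<close>

definition sign_clause :: "nat set \<Rightarrow> nat set \<Rightarrow> clause" where
  "sign_clause P S = Pos ` P \<union> Neg ` (S - P)"

lemma Pos_in_sign_clause [simp]: "Pos v \<in> sign_clause P S \<longleftrightarrow> v \<in> P"
  and Neg_in_sign_clause [simp]: "Neg v \<in> sign_clause P S \<longleftrightarrow> v \<in> S \<and> v \<notin> P"
  by (auto simp: sign_clause_def)

lemma sign_clause_eqD:
  assumes "sign_clause P S = sign_clause Q T" "P \<subseteq> S" "Q \<subseteq> T"
  shows "P = Q" "S = T"
proof -
  have "l \<in> sign_clause P S \<longleftrightarrow> l \<in> sign_clause Q T" for l
    using assms(1) by simp
  from this[of "Pos v" for v] this[of "Neg v" for v]
  have "v \<in> P \<longleftrightarrow> v \<in> Q" "v \<in> S \<and> v \<notin> P \<longleftrightarrow> v \<in> T \<and> v \<notin> Q" for v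
    by simp_all
  then show "P = Q" "S = T"
    using assms(2,3) by blast+
qed

lemma sign_clause_subset_literals: "P \<subseteq> S \<Longrightarrow> S \<subseteq> {..<n} \<Longrightarrow> sign_clause P S \<subseteq> literals n"
  by (auto simp: sign_clause_def literals_def)

lemma card_sign_clause:
  assumes "P \<subseteq> S" "finite S"
  shows "card (sign_clause P S) = card S"
proof -
  have "finite P" using assms finite_subset by auto
  have "card (sign_clause P S) = card (Pos ` P) + card (Neg ` (S - P))"
    unfolding sign_clause_def using assms \<open>finite P\<close> by (intro card_Un_disjoint) auto
  also have "\<dots> = card P + card (S - P)"
    by (simp add: card_image inj_on_def)
  also have "\<dots> = card S"
    using assms \<open>finite P\<close> by (simp add: card_Diff_subset card_mono)
  finally show ?thesis .
qed

text \<open>If \<open>S \<in> F\<close>, every sign pattern on \<open>S\<close> occurs, and any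
  assignment falsifies one of them. Otherwise the indicator of \<open>S\<close> works: each
  \<open>T \<in> F\<close> differs from \<open>S\<close> but has the same size, hence has a variable
  outside \<open>S\<close>.\<close>

lemma satisfiable_sign_clauses_iff:
  assumes set_\<phi>: "set \<phi> = sign_clause {} ` F \<union> (\<lambda>P. sign_clause P S) ` (Pow S - {{}})"
    and F: "\<And>T. T \<in> F \<Longrightarrow> finite T \<and> card T = card S" and "finite S"
  shows "satisfiable \<phi> \<longleftrightarrow> S \<notin> F"
proof
  assume "satisfiable \<phi>"
  then obtain a where a: "\<And>C. C \<in> set \<phi> \<Longrightarrow> \<exists>l\<in>C. literal_true a l"
    by (auto simp: satisfiable_def)
  show "S \<notin> F"
  proof
    assume "S \<in> F"
    define P where "P = {v \<in> S. \<not> a v}"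
    \<comment> \<open>The empty pattern is missing from the query clauses; \<open>S \<in> F\<close>
      supplies it.\<close>
    have "sign_clause P S \<in> set \<phi>"
      using \<open>S \<in> F\<close> by (cases "P = {}") (auto simp: set_\<phi> P_def)
    then obtain l where "l \<in> sign_clause P S" "literal_true a l"
      using a by blast
    then show False
      by (auto simp: sign_clause_def P_def)
  qed
next
  assume "S \<notin> F"
  have "\<exists>l\<in>C. literal_true (\<lambda>v. v \<in> S) l" if "C \<in> set \<phi>" for C
  proof -
    have "(\<exists>T\<in>F. C = sign_clause {} T) \<or> (\<exists>P\<subseteq>S. P \<noteq> {} \<and> C = sign_clause P S)"
      using that unfolding set_\<phi> by auto
    then show ?thesis
    proof (elim disjE bexE exE conjE)
      fix T assume data: "T \<in> F" "C = sign_clause {} T"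
      have "\<not> T \<subseteq> S"
        using card_subset_eq[OF \<open>finite S\<close>, of T] F[of T] data \<open>S \<notin> F\<close> by auto
      then obtain v where "v \<in> T" "v \<notin> S" by auto
      then show ?thesis
        using data by (intro bexI[of _ "Neg v"]) auto
    next
      fix P assume query: "P \<subseteq> S" "P \<noteq> {}" "C = sign_clause P S"
      then obtain v where "v \<in> P" by auto
      then show ?thesis
        using query by (intro bexI[of _ "Pos v"]) auto
    qed
  qed
  then show "satisfiable \<phi>"
    by (auto simp: satisfiable_def)
qed

section \<open>Data part and query part\<close>

text \<open>The order is irrelevant; choosing one enumeration makes the query part depend on
  \<open>S\<close> alone.\<close>

definition query_stream :: "nat set \<Rightarrow> clause list" where
  "query_stream S = (SOME cs. set cs = (\<lambda>P. sign_clause P S) ` (Pow S - {{}}) \<and> distinct cs)"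

lemma query_stream:
  assumes "finite S"
  shows set_query_stream: "set (query_stream S) = (\<lambda>P. sign_clause P S) ` (Pow S - {{}})"
    and distinct_query_stream: "distinct (query_stream S)"
proof -
  have "finite ((\<lambda>P. sign_clause P S) ` (Pow S - {{}}))"
    using assms by simp
  from someI_ex[OF finite_distinct_list[OF this]]
  show "set (query_stream S) = (\<lambda>P. sign_clause P S) ` (Pow S - {{}})" "distinct (query_stream S)"
    by (simp_all add: query_stream_def)
qed

lemma length_query_stream:
  assumes "finite S"
  shows "length (query_stream S) = 2 ^ card S - 1"
proof -
  have "length (query_stream S) = card ((\<lambda>P. sign_clause P S) ` (Pow S - {{}}))"
    using distinct_card[OF distinct_query_stream[OF assms]] by (simp add: set_query_stream assms)
  also have "\<dots> = card (Pow S - {{}})"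
    by (rule card_image) (auto intro!: inj_onI dest: sign_clause_eqD(1))
  also have "\<dots> = 2 ^ card S - 1"
    using assms by (simp add: card_Diff_singleton card_Pow)
  finally show ?thesis .
qed

definition data_stream :: "(nat \<Rightarrow> nat set) \<Rightarrow> nat \<Rightarrow> nat set \<Rightarrow> clause list" where
  "data_stream S N X = map (\<lambda>i. sign_clause {} (S (if i \<in> X then 2 * i else 2 * i + 1))) [0..<N]"

lemma length_data_stream [simp]: "length (data_stream S N X) = N"
  by (simp add: data_stream_def)

definition index_stream :: "(nat \<Rightarrow> nat set) \<Rightarrow> nat \<Rightarrow> nat set \<Rightarrow> nat \<Rightarrow> clause list" where
  "index_stream S N X j = data_stream S N X @ query_stream (S (2 * j))"

locale index_family =
  fixes S :: "nat \<Rightarrow> nat set" and N n k :: nat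
  assumes inj: "inj_on S {..<2 * N}"
    and S_subset: "i < 2 * N \<Longrightarrow> S i \<subseteq> {..<n}"
    and card_S: "i < 2 * N \<Longrightarrow> card (S i) = k"
begin

lemma finite_S: "i < 2 * N \<Longrightarrow> finite (S i)"
  using S_subset finite_subset by blast

lemma set_data_stream:
  "set (data_stream S N X) = sign_clause {} ` (\<lambda>i. S (if i \<in> X then 2 * i else 2 * i + 1)) ` {..<N}"
  by (auto simp: data_stream_def)

lemma set_index_stream:
  assumes "j < N"
  shows "set (index_stream S N X j) =
    sign_clause {} ` (\<lambda>i. S (if i \<in> X then 2 * i else 2 * i + 1)) ` {..<N} \<union>
    (\<lambda>P. sign_clause P (S (2 * j))) ` (Pow (S (2 * j)) - {{}})"
  using set_query_stream[OF finite_S, of "2 * j"] assms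
  by (simp add: index_stream_def set_data_stream)

lemma length_index_stream: "j < N \<Longrightarrow> length (index_stream S N X j) = N + (2 ^ k - 1)"
  by (simp add: index_stream_def length_query_stream finite_S card_S)

lemma kSAT_index_stream:
  assumes "j < N"
  shows "kSAT_stream n k (index_stream S N X j)"
proof -
  have "sign_clause P (S i) \<subseteq> literals n \<and> card (sign_clause P (S i)) = k"
    if "i < 2 * N" "P \<subseteq> S i" for P i
    using that by (simp add: sign_clause_subset_literals S_subset card_sign_clause finite_S card_S)
  then show ?thesis
    unfolding kSAT_stream_def set_index_stream[OF assms] using assms by (simp add: ball_Un)
qed

text \<open>Data clauses have pairwise different variable sets. They differ from the query clauses
  because only the latter have a nonempty positive part.\<close>

lemma distinct_index_stream:
  assumes "j < N"
  shows "distinct (index_stream S N X j)"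
proof -
  have "distinct (data_stream S N X)"
    unfolding data_stream_def distinct_map
  proof (intro conjI inj_onI)
    fix i i' assume less: "i \<in> set [0..<N]" "i' \<in> set [0..<N]"
      and "sign_clause {} (S (if i \<in> X then 2 * i else 2 * i + 1)) =
           sign_clause {} (S (if i' \<in> X then 2 * i' else 2 * i' + 1))"
    then have "S (if i \<in> X then 2 * i else 2 * i + 1) = S (if i' \<in> X then 2 * i' else 2 * i' + 1)"
      by (auto dest: sign_clause_eqD(2))
    then have "(if i \<in> X then 2 * i else 2 * i + 1) = (if i' \<in> X then 2 * i' else 2 * i' + 1)"
      by (rule inj_onD[OF inj]) (use less in auto)
    then show "i = i'"
      by (auto split: if_splits)
  qed simp
  moreover have "set (data_stream S N X) \<inter> set (query_stream (S (2 * j))) = {}"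
    using assms
    by (auto simp: set_data_stream set_query_stream finite_S dest!: sign_clause_eqD(1))
  ultimately show ?thesis
    using assms by (simp add: index_stream_def distinct_query_stream finite_S)
qed

text \<open>By injectivity of \<open>S\<close> only indices matter, and by parity the index
  \<open>2 * j\<close> is sent only for \<open>i = j\<close> and \<open>j \<in> X\<close>.\<close>

lemma satisfiable_index_stream_iff:
  assumes "j < N"
  shows "satisfiable (index_stream S N X j) \<longleftrightarrow> j \<notin> X"
proof -
  let ?F = "(\<lambda>i. S (if i \<in> X then 2 * i else 2 * i + 1)) ` {..<N}"
  have "satisfiable (index_stream S N X j) \<longleftrightarrow> S (2 * j) \<notin> ?F"
    using assms by (intro satisfiable_sign_clauses_iff set_index_stream) (auto simp: finite_S card_S)
  also have "S (2 * j) \<in> ?F \<longleftrightarrow> j \<in> X"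
  proof
    assume "S (2 * j) \<in> ?F"
    then obtain i where i: "i < N" "S (2 * j) = S (if i \<in> X then 2 * i else 2 * i + 1)"
      by auto
    have "2 * j = (if i \<in> X then 2 * i else 2 * i + 1)"
      using inj_onD[OF inj i(2)] i(1) assms by auto
    then show "j \<in> X"
      by (auto split: if_splits) presburger
  qed (use assms in auto)
  finally show ?thesis by simp
qed

end

section \<open>Streaming algorithms\<close>

lemma run_append: "run A r \<mu> (\<phi> @ \<psi>) = run A r (run A r \<mu> \<phi>) \<psi>"
  by (induction \<phi> arbitrary: \<mu>) simp_all

lemma run_bind: "run A r (bind_pmf \<mu> f) \<phi> = bind_pmf \<mu> (\<lambda>\<sigma>. run A r (f \<sigma>) \<phi>)"
  by (induction \<phi> arbitrary: f) (simp_all add: bind_assoc_pmf)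

text \<open>For a fixed seed value, the second part of the stream sees the first only through the
  memory content \<open>\<sigma>\<close>.\<close>

lemma memory_append:
  "memory A r (\<phi> @ \<psi>) = bind_pmf (memory A r \<phi>) (\<lambda>\<sigma>. run A r (return_pmf \<sigma>) \<psi>)"
  using run_bind[of A r "memory A r \<phi>" return_pmf \<psi>]
  by (simp add: memory_def run_append bind_return_pmf')

section \<open>Average success of a space-bounded algorithm\<close>

context index_family
begin

lemma sum_success_prob_le:
  assumes space: "\<And>X j. X \<subseteq> {..<N} \<Longrightarrow> j < N \<Longrightarrow> space_at_most A (index_stream S N X j) s"
    and "N > 0"
  shows "(\<Sum>X\<in>Pow {..<N}. \<Sum>j<N. success_prob A (index_stream S N X j))
         \<le> 2 ^ N * (11/16 * real N + 2 * real s)"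
proof -
  define M where "M = {\<sigma> :: bool list. length \<sigma> \<le> s}"
  have "finite M"
    by (simp add: M_def finite_bool_lists_length_le)
  moreover have "[] \<in> M"
    by (simp add: M_def)
  ultimately have "card M > 0"
    by (auto simp: card_gt_0_iff)
  then have "ln (card M) \<le> ln (real (4 ^ s))"
    using card_bool_lists_length_le[of s] unfolding M_def
    by (simp only: ln_le_cancel_iff of_nat_0_less_iff of_nat_le_iff zero_less_power
        zero_less_numeral)
  also have "\<dots> = 2 * real s * ln 2"
    using ln_realpow[of 2 2] by (simp add: ln_realpow)
  also have "\<dots> \<le> 2 * real s * 1"
    using ln_2_less_1 by (intro mult_left_mono) simp_all
  finally have ln_M: "ln (card M) \<le> 2 * real s" by simp
  define q where
    "q r j \<sigma> = bind_pmf (run A r (return_pmf \<sigma>) (query_stream (S (2 * j)))) (answer A r)" for r j \<sigma>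
  \<comment> \<open>With the seed fixed, memory is the only link from data to query, so the indexing
    bound applies. The average over seeds is taken afterwards.\<close>
  have seed_bound:
    "(\<Sum>X\<in>Pow {..<N}. \<Sum>j<N. pmf (bind_pmf (memory A r (data_stream S N X)) (q r j)) (j \<notin> X))
      \<le> 2 ^ N * (11/16 * real N + 2 * real s)" if r: "r \<in> set_pmf (seed A)" for r
  proof -
    have "set_pmf (memory A r (data_stream S N X)) \<subseteq> M" if "X \<subseteq> {..<N}" for X
    proof
      fix \<sigma> assume "\<sigma> \<in> set_pmf (memory A r (data_stream S N X))"
      \<comment> \<open>The data part is a prefix of the stream for any query, so query
        \<open>0\<close> suffices to bound the memory at its end.\<close>
      moreover have "take N (index_stream S N X 0) = data_stream S N X"
        by (simp add: index_stream_def)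
      moreover have "N \<le> length (index_stream S N X 0)"
        by (simp add: index_stream_def)
      ultimately show "\<sigma> \<in> M"
        using space[OF that \<open>N > 0\<close>] r unfolding space_at_most_def M_def by auto
    qed
    then have "(\<Sum>X\<in>Pow {..<N}. \<Sum>j<N. pmf (bind_pmf (memory A r (data_stream S N X)) (q r j)) (j \<notin> X))
      \<le> 2 ^ card {..<N} * (11/16 * card {..<N} + ln (card M))"
      using \<open>finite M\<close> by (intro index_success_le) auto
    also have "\<dots> \<le> 2 ^ N * (11/16 * real N + 2 * real s)"
      using ln_M by simp
    finally show ?thesis .
  qed
  have int: "integrable (measure_pmf (seed A)) (\<lambda>r. pmf (p r) b)"
    for p :: "nat \<Rightarrow> bool pmf" and b
    by (rule measure_pmf.integrable_const_bound[where B = 1]) (auto simp: pmf_le_1)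
  have "success_prob A (index_stream S N X j) = measure_pmf.expectation (seed A)
      (\<lambda>r. pmf (bind_pmf (memory A r (data_stream S N X)) (q r j)) (j \<notin> X))" if "j < N" for X j
    using that unfolding success_prob_def verdict_def satisfiable_index_stream_iff[OF that] q_def
    by (simp add: index_stream_def memory_append bind_assoc_pmf pmf_bind[of "seed A"])
  then have "(\<Sum>X\<in>Pow {..<N}. \<Sum>j<N. success_prob A (index_stream S N X j)) =
      measure_pmf.expectation (seed A)
      (\<lambda>r. \<Sum>X\<in>Pow {..<N}. \<Sum>j<N. pmf (bind_pmf (memory A r (data_stream S N X)) (q r j)) (j \<notin> X))"
    by (simp add: int)
  also have "\<dots> \<le> 2 ^ N * (11/16 * real N + 2 * real s)"
    by (rule measure_pmf.integral_le_const) (use seed_bound in \<open>simp_all add: int AE_measure_pmf_iff\<close>)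
  finally show ?thesis .
qed

definition hard_distribution :: "clause list pmf" where
  "hard_distribution =
    map_pmf (\<lambda>(X, j). index_stream S N X j) (pmf_of_set (Pow {..<N} \<times> {..<N}))"

lemma set_hard_distribution:
  assumes "N > 0"
  shows "set_pmf hard_distribution = (\<lambda>(X, j). index_stream S N X j) ` (Pow {..<N} \<times> {..<N})"
proof -
  have "Pow {..<N} \<times> {..<N} \<noteq> {}"
    using assms by auto
  then show ?thesis
    by (simp add: hard_distribution_def set_pmf_of_set)
qed

lemma index_space_lower_bound:
  assumes "N > 0"
    and success: "measure_pmf.expectation hard_distribution (success_prob A) \<ge> 3/4"
    and space: "\<And>\<phi>. \<phi> \<in> set_pmf hard_distribution \<Longrightarrow> space_at_most A \<phi> s"
  shows "real N \<le> 32 * real s"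
proof -
  have space_index: "space_at_most A (index_stream S N X j) s" if "X \<subseteq> {..<N}" "j < N" for X j
    by (rule space) (use that in \<open>force simp: set_hard_distribution[OF \<open>N > 0\<close>]\<close>)
  have "Pow {..<N} \<times> {..<N} \<noteq> {}"
    using assms by auto
  then have "measure_pmf.expectation hard_distribution (success_prob A) =
      (\<Sum>(X, j)\<in>Pow {..<N} \<times> {..<N}. success_prob A (index_stream S N X j)) / (2 ^ N * N)"
    by (simp add: hard_distribution_def integral_pmf_of_set card_cartesian_product card_Pow
        case_prod_unfold)
  also have "\<dots> = (\<Sum>X\<in>Pow {..<N}. \<Sum>j<N. success_prob A (index_stream S N X j)) / (2 ^ N * N)"
    by (simp add: sum.cartesian_product)
  also have "\<dots> \<le> 2 ^ N * (11/16 * real N + 2 * real s) / (2 ^ N * N)"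
    using space_index assms(1) by (intro divide_right_mono sum_success_prob_le) auto
  also have "\<dots> = (11/16 * real N + 2 * real s) / N"
    by simp
  \<comment> \<open>The gap \<open>3/4 - 11/16 = 1/16\<close> gives
    \<open>N/16 \<le> 2 * s\<close>.\<close>
  finally have "3/4 \<le> (11/16 * real N + 2 * real s) / N"
    using success by linarith
  then show ?thesis
    using assms(1) by (simp add: field_simps)
qed

end

lemma expectation_success_prob_ge:
  assumes "solves_kSAT n k p A" "\<And>\<phi>. \<phi> \<in> set_pmf D \<Longrightarrow> kSAT_stream n k \<phi>"
  shows "p \<le> measure_pmf.expectation D (success_prob A)"
proof (rule measure_pmf.integral_ge_const)
  show "integrable (measure_pmf D) (success_prob A)"
    by (rule measure_pmf.integrable_const_bound[where B = 1])
      (simp_all add: success_prob_def pmf_le_1)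
  show "AE \<phi> in measure_pmf D. p \<le> success_prob A \<phi>"
    using assms by (auto simp: AE_measure_pmf_iff solves_kSAT_def)
qed

section \<open>Choice of the family and of the parameters\<close>

lemma ex_index_family:
  assumes "2 * N \<le> n choose k"
  shows "\<exists>S. index_family S N n k"
proof -
  let ?F = "{T. T \<subseteq> {..<n} \<and> card T = k}"
  have "finite ?F"
    by simp
  have "card ?F = n choose k"
    using n_subsets[of "{..<n}" k] by simp
  with ex_bij_betw_nat_finite[OF \<open>finite ?F\<close>] obtain S where S: "bij_betw S {0..<n choose k} ?F"
    by auto
  have "index_family S N n k"
  proof
    show "inj_on S {..<2 * N}"
      using S assms by (auto simp: bij_betw_def intro: inj_on_subset)
  qed (use bij_betwE[OF S] assms in auto)
  then show ?thesis
    by (rule exI[of _ S])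
qed

text \<open>The average-case conjunct carries the lower bound. The worst-case one follows from it,
  since success on every stream implies success on average over \<open>D\<close>.\<close>

theorem theorem2:
  "\<exists>c>0. \<exists>a>0. \<exists>b>0. \<forall>n k :: nat. 1 \<le> k \<and> real k \<le> real n / exp 1 \<longrightarrow>
     (\<exists>D :: clause list pmf.
        (\<forall>\<phi>\<in>set_pmf D. kSAT_stream n k \<phi> \<and> distinct \<phi>) \<and>
        measure_pmf.prob D {\<phi>. a * (real n / real k) ^ k \<le> real (length \<phi>) \<and>
                               real (length \<phi>) \<le> b * (real n / real k) ^ k} \<ge> 1 - 1 / real n \<and>
        (\<forall>A s. solves_kSAT n k (3/4) A \<and> (\<forall>\<phi>\<in>set_pmf D. space_at_most A \<phi> s) \<longrightarrow>
               (\<forall>\<phi>\<in>set_pmf D. c * real (length \<phi>) \<le> real s)) \<and>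
        (\<forall>A s. measure_pmf.expectation D (success_prob A) \<ge> 3/4 \<and>
               (\<forall>\<phi>\<in>set_pmf D. space_at_most A \<phi> s) \<longrightarrow>
               (\<forall>\<phi>\<in>set_pmf D. c * real (length \<phi>) \<le> real s)))"
proof (rule exI[of _ "1/160"], intro conjI, simp,
    rule exI[of _ "1/4"], intro conjI, simp,
    rule exI[of _ 2], intro conjI, simp, intro allI impI)
  \<comment> \<open>All lengths equal \<open>N + 2 ^ k - 1\<close>, with
    \<open>T/4 \<le> N \<le> T/2\<close> and \<open>2 ^ k \<le> T\<close> for the \<open>T\<close>
    and \<open>N\<close> below. So they lie between \<open>T/4\<close> and \<open>2 * T\<close>, and
    are at most \<open>5 * N\<close>; with \<open>N \<le> 32 * s\<close> this yields
    \<open>1/160\<close>.\<close>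
  fix n k :: nat
  assume nk: "1 \<le> k \<and> real k \<le> real n / exp 1"
  define T where "T = (real n / real k) ^ k"
  define N where "N = nat \<lfloor>T / 2\<rfloor>"
  have "2 \<le> exp (1::real)"
    using exp_ge_add_one_self[of 1] by simp
  also have e_le: "exp 1 \<le> real n / real k"
    using nk by (simp add: field_simps)
  finally have two_le: "2 \<le> real n / real k" .
  \<comment> \<open>The hypothesis \<open>k \<le> n/e\<close> enters here: it keeps the query part
    within the order of the data part.\<close>
  then have T_ge: "2 ^ k \<le> T"
    unfolding T_def by (intro power_mono) auto
  moreover have "(2::real) ^ 1 \<le> 2 ^ k"
    using nk by (intro power_increasing) auto
  ultimately have "2 \<le> T" by simp
  \<comment> \<open>\<open>T \<ge> 2\<close> ensures that rounding \<open>T / 2\<close> down costs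
    at most a factor of 2.\<close>
  then have "N > 0" and N_le: "2 * real N \<le> T" and N_gt: "T < 2 * real N + 2"
    unfolding N_def by linarith+
  then have T_le: "T \<le> 4 * real N" by linarith
  have "k \<le> n"
  proof -
    have "1 \<le> real n / real k" using two_le by simp
    then show ?thesis using nk by (simp add: field_simps)
  qed
  then have "T \<le> real (n choose k)"
    unfolding T_def by (rule binomial_ge_n_over_k_pow_k)
  then have "2 * N \<le> n choose k"
    using N_le by linarith
  then obtain S where "index_family S N n k"
    using ex_index_family by blast
  then interpret index_family S N n k .
  note supp = set_hard_distribution[OF \<open>N > 0\<close>]
  have streams: "kSAT_stream n k \<phi> \<and> distinct \<phi>" if "\<phi> \<in> set_pmf hard_distribution" for \<phi>
    using that by (auto simp: supp kSAT_index_stream distinct_index_stream)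
  have len: "real (length \<phi>) = real N + (2 ^ k - 1)" if "\<phi> \<in> set_pmf hard_distribution" for \<phi>
    using that by (auto simp: supp length_index_stream of_nat_diff)
  have pow_ge: "(1::real) \<le> 2 ^ k" by simp
  have lower: "1/160 * real (length \<phi>) \<le> real s"
    if "measure_pmf.expectation hard_distribution (success_prob A) \<ge> 3/4"
      "\<forall>\<phi>\<in>set_pmf hard_distribution. space_at_most A \<phi> s" "\<phi> \<in> set_pmf hard_distribution" for A s \<phi>
    using index_space_lower_bound[OF \<open>N > 0\<close> that(1), of s] that(2) len[OF that(3)] T_ge T_le
    by simp
  have "measure_pmf.prob hard_distribution
      {\<phi>. 1/4 * T \<le> real (length \<phi>) \<and> real (length \<phi>) \<le> 2 * T} = 1"
  proof (subst measure_pmf.prob_eq_1)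
    show "AE \<phi> in measure_pmf hard_distribution.
        \<phi> \<in> {\<phi>. 1/4 * T \<le> real (length \<phi>) \<and> real (length \<phi>) \<le> 2 * T}"
    proof (rule AE_pmfI)
      fix \<phi> assume "\<phi> \<in> set_pmf hard_distribution"
      from len[OF this] show "\<phi> \<in> {\<phi>. 1/4 * T \<le> real (length \<phi>) \<and> real (length \<phi>) \<le> 2 * T}"
        using T_ge T_le N_le pow_ge \<open>2 \<le> T\<close> unfolding mem_Collect_eq by linarith
    qed
  qed simp
  then have "1 - 1 / real n \<le> measure_pmf.prob hard_distribution
      {\<phi>. 1/4 * T \<le> real (length \<phi>) \<and> real (length \<phi>) \<le> 2 * T}"
    by simp
  moreover have "3/4 \<le> measure_pmf.expectation hard_distribution (success_prob A)"
    if "solves_kSAT n k (3/4) A" for A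
    using that streams by (intro expectation_success_prob_ge) auto
  ultimately show "\<exists>D :: clause list pmf.
        (\<forall>\<phi>\<in>set_pmf D. kSAT_stream n k \<phi> \<and> distinct \<phi>) \<and>
        measure_pmf.prob D {\<phi>. 1/4 * (real n / real k) ^ k \<le> real (length \<phi>) \<and>
                               real (length \<phi>) \<le> 2 * (real n / real k) ^ k} \<ge> 1 - 1 / real n \<and>
        (\<forall>A s. solves_kSAT n k (3/4) A \<and> (\<forall>\<phi>\<in>set_pmf D. space_at_most A \<phi> s) \<longrightarrow>
               (\<forall>\<phi>\<in>set_pmf D. 1/160 * real (length \<phi>) \<le> real s)) \<and>
        (\<forall>A s. measure_pmf.expectation D (success_prob A) \<ge> 3/4 \<and>
               (\<forall>\<phi>\<in>set_pmf D. space_at_most A \<phi> s) \<longrightarrow>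
               (\<forall>\<phi>\<in>set_pmf D. 1/160 * real (length \<phi>) \<le> real s))"
    unfolding T_def[symmetric] using streams lower by (intro exI[of _ hard_distribution]) blast
qed

end
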